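(* For every pair of integers $k\ge 3$ and $l\ge 1$, there exists a graph $G$ with $\chi(G)=k$, $ir(G)=l$ and $\chi_i(G)=k+l-1$.
   Context: All graphs are finite, simple, undirected and connected. Neighborhoods and private neighbors. For a vertex $v$ of a graph $G$, $N[v]$ denotes the closed neighborhood of $v$. For $S\subseteq V(G)$, $N[S]=\bigcup_{v\in S}N[v]$. For $v\in S$, $pn[v,S]=N[v]\setminus N[S\setminus\{v\}]$. Irredundance. A set $S\subseteq V(G)$ is irredundant if $pn[v,S]\neq\emptyset$ for every $v\in S$. It is a maximal irredundant set if $S$ is irredundant and $S\cup\{w\}$ is not irredundant for every $w\in V(G)\setminus S$. The lower irredundance number $ir(G)$ is the minimum cardinality of a maximal irredundant set of $G$. Colorings. $\chi(G)$ is the chromatic number of $G$. An irredundance coloring of $G$ is a proper coloring for which there exists a maximal irredundant set $R$ of $G$ whose vertices all receive pairwise different colors. The irredundance chromatic number $\chi_i(G)$ is the minimum number of colors in an irredundance coloring of $G$. *)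

theory Defs
  imports "Graph_Theory.Graph_Theory"
begin

text \<open>
  A finite simple undirected graph is a \<^locale>\<open>pair_graph\<close>: a finite vertex set with a symmetric
  irreflexive adjacency relation \<^term>\<open>parcs G\<close>, each undirected edge being represented by its
  two orientations.
\<close>

definition closed_nbhd :: "'a pair_pre_digraph \<Rightarrow> 'a \<Rightarrow> 'a set" where
  "closed_nbhd G v = insert v {u \<in> pverts G. (v, u) \<in> parcs G}"

definition closed_nbhd_set :: "'a pair_pre_digraph \<Rightarrow> 'a set \<Rightarrow> 'a set" where
  "closed_nbhd_set G S = (\<Union>v\<in>S. closed_nbhd G v)"

definition private_nbhd :: "'a pair_pre_digraph \<Rightarrow> 'a \<Rightarrow> 'a set \<Rightarrow> 'a set" where
  "private_nbhd G v S = closed_nbhd G v - closed_nbhd_set G (S - {v})"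

definition irredundant :: "'a pair_pre_digraph \<Rightarrow> 'a set \<Rightarrow> bool" where
  "irredundant G S \<longleftrightarrow> S \<subseteq> pverts G \<and> (\<forall>v\<in>S. private_nbhd G v S \<noteq> {})"

definition maximal_irredundant :: "'a pair_pre_digraph \<Rightarrow> 'a set \<Rightarrow> bool" where
  "maximal_irredundant G S \<longleftrightarrow>
     irredundant G S \<and> (\<forall>w \<in> pverts G - S. \<not> irredundant G (S \<union> {w}))"

definition lower_irredundance_number :: "'a pair_pre_digraph \<Rightarrow> nat" where
  "lower_irredundance_number G = (LEAST n. \<exists>S. maximal_irredundant G S \<and> card S = n)"

definition proper_coloring :: "'a pair_pre_digraph \<Rightarrow> ('a \<Rightarrow> nat) \<Rightarrow> bool" where
  "proper_coloring G c \<longleftrightarrow> (\<forall>(u, v) \<in> parcs G. c u \<noteq> c v)"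

text \<open>The number of colors of a coloring is the number of colors used on the vertices.\<close>

definition chromatic_number :: "'a pair_pre_digraph \<Rightarrow> nat" where
  "chromatic_number G = (LEAST n. \<exists>c. proper_coloring G c \<and> card (c ` pverts G) = n)"

definition irredundance_coloring :: "'a pair_pre_digraph \<Rightarrow> ('a \<Rightarrow> nat) \<Rightarrow> bool" where
  "irredundance_coloring G c \<longleftrightarrow>
     proper_coloring G c \<and> (\<exists>R. maximal_irredundant G R \<and> inj_on c R)"

definition irredundance_chromatic_number :: "'a pair_pre_digraph \<Rightarrow> nat" where
  "irredundance_chromatic_number G =
     (LEAST n. \<exists>c. irredundance_coloring G c \<and> card (c ` pverts G) = n)"

text \<open>The three minima range over nonempty sets.\<close>

lemma ex_maximal_irredundant:
  assumes "finite (pverts G)"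
  shows "\<exists>S. maximal_irredundant G S"
proof -
  have "finite {S. irredundant G S}"
    using assms by (rule finite_subset[rotated, OF finite_Pow_iff[THEN iffD2]])
      (auto simp: irredundant_def)
  moreover have "{} \<in> {S. irredundant G S}"
    by (simp add: irredundant_def)
  ultimately obtain S where "irredundant G S" "\<And>T. irredundant G T \<Longrightarrow> S \<subseteq> T \<Longrightarrow> S = T"
    using finite_has_maximal[of "{S. irredundant G S}"] by blast
  then show ?thesis
    unfolding maximal_irredundant_def by (metis Diff_iff Un_insert_right insertI1 sup_bot_right subset_insertI)
qed

lemma ex_irredundance_coloring:
  assumes "pair_graph G"
  shows "\<exists>c. irredundance_coloring G c"
proof -
  interpret pair_graph G by (fact assms)
  obtain c :: "'a \<Rightarrow> nat" where c: "inj_on c (pverts G)"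
    using finite_imp_inj_to_nat_seg[OF pair_finite_verts] by blast
  have "proper_coloring G c"
    unfolding proper_coloring_def
    using c pair_no_loops in_arcsD1 in_arcsD2 by (fastforce dest: inj_onD)
  moreover obtain R where "maximal_irredundant G R"
    using ex_maximal_irredundant[OF pair_finite_verts] by blast
  moreover from this have "inj_on c R"
    using c by (auto simp: maximal_irredundant_def irredundant_def intro: inj_on_subset)
  ultimately show ?thesis
    by (auto simp: irredundance_coloring_def)
qed

end

theory Submission
  imports Defs "HOL-Library.Nat_Bijection"
begin

text \<open>
  Take \<open>l\<close> pairwise nonadjacent hubs, all joined to every vertex of a clique (the core) of size
  \<open>k - 1\<close>. Every hub gets many pendant vertices, and for every hub and every core vertex one of the
  pendants of the hub is also joined to the core vertex; this keeps the chromatic number at \<open>k\<close>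
  because \<open>k \<ge> 3\<close>.

  Suppose that a maximal irredundant set \<open>S\<close> misses a hub \<open>h\<close> and a degree-one pendant \<open>x\<close> of \<open>h\<close>.
  Adding \<open>x\<close> destroys irredundance, so some \<open>s\<close> in \<open>S\<close> has \<open>h\<close> as its only private neighbor. But a
  pendant \<open>s\<close> would have itself as private neighbor, and a core vertex \<open>s\<close> the common pendant
  of \<open>s\<close> and \<open>h\<close>. Hence \<open>S\<close> contains all hubs, or all the many degree-one pendants of one hub. In the first
  case a coloring that is injective on \<open>S\<close> uses \<open>l\<close> colors on the hubs and \<open>k - 1\<close> others on the core.
\<close>

section \<open>The graph of hubs, core and pendants\<close>

definition hub :: "nat \<Rightarrow> nat" where
  "hub i = 3 * i"

definition core :: "nat \<Rightarrow> nat" where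
  "core j = 3 * j + 1"

text \<open>Residues modulo 3 separate hubs, core vertices and pendants inside the naturals, so a
  coloring can recover the kind and the indices of a vertex by arithmetic.\<close>

definition pend :: "nat \<Rightarrow> nat \<Rightarrow> nat" where
  "pend i j = 3 * prod_encode (i, j) + 2"

lemma vertex_eq_iff [simp]:
  "hub i = hub i' \<longleftrightarrow> i = i'"
  "core j = core j' \<longleftrightarrow> j = j'"
  "pend i j = pend i' j' \<longleftrightarrow> i = i' \<and> j = j'"
  "hub i \<noteq> core j" "core j \<noteq> hub i"
  "hub i \<noteq> pend i' j" "pend i' j \<noteq> hub i"
  "core j \<noteq> pend i j'" "pend i j' \<noteq> core j"
  unfolding hub_def core_def pend_def by auto presburger+

text \<open>Edges between different kinds of vertices appear in one orientation only;
  \<open>hub_graph\<close> adds the converse. The pendants with index at least \<open>k - 1\<close>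
  have degree one, and the bound \<open>2 * k + l\<close> provides at least \<open>k + l\<close> of
  them at each hub.\<close>

definition edges :: "nat \<Rightarrow> nat \<Rightarrow> (nat \<times> nat) set" where
  "edges k l =
     {(core i, core j) | i j. i < k - 1 \<and> j < k - 1 \<and> i \<noteq> j} \<union>
     {(hub i, core j) | i j. i < l \<and> j < k - 1} \<union>
     {(hub i, pend i j) | i j. i < l \<and> j < 2 * k + l} \<union>
     {(core j, pend i j) | i j. i < l \<and> j < k - 1}"

definition hub_graph :: "nat \<Rightarrow> nat \<Rightarrow> nat pair_pre_digraph" where
  "hub_graph k l =
     \<lparr>pverts = hub ` {..<l} \<union> core ` {..<k - 1} \<union>
        {pend i j | i j. i < l \<and> j < 2 * k + l},
      parcs = edges k l \<union> (edges k l)\<inverse>\<rparr>"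

lemma pverts_hub_graph:
  "pverts (hub_graph k l) = hub ` {..<l} \<union> core ` {..<k - 1} \<union>
     {pend i j | i j. i < l \<and> j < 2 * k + l}"
  by (simp add: hub_graph_def)

lemma parcs_hub_graph: "parcs (hub_graph k l) = edges k l \<union> (edges k l)\<inverse>"
  by (simp add: hub_graph_def)

lemma finite_pverts_hub_graph: "finite (pverts (hub_graph k l))"
proof -
  have "{pend i j | i j. i < l \<and> j < 2 * k + l} = case_prod pend ` ({..<l} \<times> {..<2 * k + l})"
    by auto
  then show ?thesis
    by (simp add: pverts_hub_graph)
qed

lemma finite_maximal_irredundant:
  "maximal_irredundant (hub_graph k l) S \<Longrightarrow> finite S"
  using finite_subset[OF _ finite_pverts_hub_graph]
  by (auto simp: maximal_irredundant_def irredundant_def)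

lemma hub_graph_cases:
  assumes "v \<in> pverts (hub_graph k l)"
  obtains (hub) i where "v = hub i" "i < l"
    | (core) j where "v = core j" "j < k - 1"
    | (pend) i j where "v = pend i j" "i < l" "j < 2 * k + l"
  using assms by (auto simp: pverts_hub_graph)

lemma pair_graph_hub_graph: "pair_graph (hub_graph k l)"
proof
  show "finite (pverts (hub_graph k l))" by (rule finite_pverts_hub_graph)
  show wf: "fst e \<in> pverts (hub_graph k l)" "snd e \<in> pverts (hub_graph k l)"
    if "e \<in> parcs (hub_graph k l)" for e
    using that by (auto simp: pverts_hub_graph parcs_hub_graph edges_def)
  show "fst e \<noteq> snd e" if "e \<in> parcs (hub_graph k l)" for e
    using that by (auto simp: parcs_hub_graph edges_def)
  have "parcs (hub_graph k l) \<subseteq> pverts (hub_graph k l) \<times> pverts (hub_graph k l)"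
    using wf by force
  then show "finite (parcs (hub_graph k l))"
    by (rule finite_subset) (simp add: finite_pverts_hub_graph)
  show "symmetric (with_proj (hub_graph k l))"
    by (auto simp: symmetric_def arcs_ends_conv parcs_hub_graph sym_def)
qed

lemma connected_hub_graph:
  assumes "l \<ge> 1" and "k \<ge> 2"
  shows "connected (with_proj (hub_graph k l))"
proof -
  let ?G = "with_proj (hub_graph k l)"
  interpret pair_graph "hub_graph k l" by (rule pair_graph_hub_graph)
  have step: "u \<rightarrow>\<^sup>*\<^bsub>?G\<^esub> v" if "(u, v) \<in> parcs (hub_graph k l)" for u v
    using that by (intro adj_in_verts reachable_adjI) simp_all
  have 1: "hub i \<rightarrow>\<^sup>*\<^bsub>?G\<^esub> core 0" if "i < l" for i
    using that assms by (intro step) (auto simp: parcs_hub_graph edges_def)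
  have to_core: "v \<rightarrow>\<^sup>*\<^bsub>?G\<^esub> core 0" if "v \<in> pverts (hub_graph k l)" for v
    using that
  proof (cases rule: hub_graph_cases)
    case (core j)
    \<comment> \<open>The detour through \<open>hub 0\<close> also covers \<open>j = 0\<close>,
      where there is no edge from \<open>core j\<close> to \<open>core 0\<close>.\<close>
    then have "core j \<rightarrow>\<^sup>*\<^bsub>?G\<^esub> hub 0"
      using assms by (intro step) (auto simp: parcs_hub_graph edges_def)
    then show ?thesis
      using 1[of 0] assms core by (auto intro: reachable_trans)
  next
    case (pend i j)
    then have "pend i j \<rightarrow>\<^sup>*\<^bsub>?G\<^esub> hub i"
      by (intro step) (auto simp: parcs_hub_graph edges_def)
    then show ?thesis
      using 1[of i] pend by (auto intro: reachable_trans)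
  qed (use 1 in auto)
  show ?thesis
  proof (rule connectedI)
    show "pverts (hub_graph k l) \<noteq> {}"
      using assms by (auto simp: pverts_hub_graph lessThan_empty_iff)
    show "u \<rightarrow>\<^sup>*\<^bsub>mk_symmetric ?G\<^esub> v" if "u \<in> pverts (hub_graph k l)" "v \<in> pverts (hub_graph k l)"
      for u v
      using to_core[of u] to_core[of v] that symmetric_reachable[OF sym_arcs, of v "core 0"]
      by (auto intro!: reachable_mk_symmetricI intro: reachable_trans)
  qed
qed

section \<open>Closed neighborhoods and maximal irredundant sets\<close>

lemma closed_nbhd_hub:
  "i < l \<Longrightarrow> closed_nbhd (hub_graph k l) (hub i) =
     insert (hub i) (core ` {..<k - 1} \<union> pend i ` {..<2 * k + l})"
  by (auto simp: closed_nbhd_def parcs_hub_graph pverts_hub_graph edges_def)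

lemma closed_nbhd_core:
  "j < k - 1 \<Longrightarrow> closed_nbhd (hub_graph k l) (core j) =
     hub ` {..<l} \<union> core ` {..<k - 1} \<union> (\<lambda>i. pend i j) ` {..<l}"
  by (auto simp: closed_nbhd_def parcs_hub_graph pverts_hub_graph edges_def)

lemma closed_nbhd_pend:
  "i < l \<Longrightarrow> j < 2 * k + l \<Longrightarrow> closed_nbhd (hub_graph k l) (pend i j) =
     {pend i j, hub i} \<union> (if j < k - 1 then {core j} else {})"
  by (auto simp: closed_nbhd_def parcs_hub_graph pverts_hub_graph edges_def)

lemma in_private_nbhd_iff:
  "p \<in> private_nbhd G v S \<longleftrightarrow>
     p \<in> closed_nbhd G v \<and> (\<forall>u\<in>S. u \<noteq> v \<longrightarrow> p \<notin> closed_nbhd G u)"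
  by (auto simp: private_nbhd_def closed_nbhd_set_def)

lemma self_in_closed_nbhd: "v \<in> closed_nbhd G v"
  by (simp add: closed_nbhd_def)

lemma closed_nbhd_sym:
  assumes "pair_graph G" "u \<in> pverts G" "v \<in> closed_nbhd G u"
  shows "u \<in> closed_nbhd G v"
proof -
  interpret pair_graph G by (fact assms)
  show ?thesis using assms arcs_symmetric by (auto simp: closed_nbhd_def)
qed

text \<open>The hubs form a dominating set in which each hub has its own pendants as private
  neighbors. A vertex added to a dominating set has no private neighbor left, whence
  maximality.\<close>

lemma maximal_irredundant_hubs:
  assumes "l \<ge> 1" "k \<ge> 2"
  shows "maximal_irredundant (hub_graph k l) (hub ` {..<l})"
  unfolding maximal_irredundant_def
proof (intro conjI ballI)
  let ?G = "hub_graph k l" and ?H = "hub ` {..<l}"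
  have "pend i k \<in> private_nbhd ?G (hub i) ?H" if "i < l" for i
    using that assms by (auto simp: in_private_nbhd_iff closed_nbhd_hub)
  then show "irredundant ?G ?H"
    by (fastforce simp: irredundant_def pverts_hub_graph)
  fix w assume w: "w \<in> pverts ?G - ?H"
  have dom: "\<exists>i<l. v \<in> closed_nbhd ?G (hub i)" if "v \<in> pverts ?G" for v
    using that
  proof (cases rule: hub_graph_cases)
    case (core j)
    then show ?thesis using assms by (intro exI[of _ 0]) (auto simp: closed_nbhd_hub)
  qed (auto simp: closed_nbhd_hub)
  have "closed_nbhd ?G w \<subseteq> pverts ?G"
    using w by (auto simp: closed_nbhd_def)
  with dom w have "private_nbhd ?G w (?H \<union> {w}) = {}"
    by (auto simp: in_private_nbhd_iff) (metis image_eqI lessThan_iff subsetD)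
  then show "\<not> irredundant ?G (?H \<union> {w})"
    by (auto simp: irredundant_def)
qed

text \<open>As \<open>k - 1 \<le> j\<close>, the new vertex has degree one and dominates only itself
  and \<open>hub i\<close>. It is its own private neighbor, so only an \<open>s\<close> in
  \<open>S\<close> with \<open>hub i\<close> as sole private neighbor could obstruct, and there is
  none.\<close>

lemma irredundant_insert_pend:
  assumes S: "irredundant (hub_graph k l) S" and i: "i < l" "hub i \<notin> S"
    and j: "k - 1 \<le> j" "j < 2 * k + l" "pend i j \<notin> S"
  shows "irredundant (hub_graph k l) (S \<union> {pend i j})"
proof -
  let ?G = "hub_graph k l" and ?x = "pend i j"
  have SV: "S \<subseteq> pverts ?G"
    using S by (simp add: irredundant_def)
  have x: "?x \<in> pverts ?G" and Nx: "closed_nbhd ?G ?x = {?x, hub i}"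
    using i j by (auto simp: pverts_hub_graph closed_nbhd_pend)
  have x_undom: "?x \<notin> closed_nbhd ?G s" if "s \<in> S" for s
    using closed_nbhd_sym[OF pair_graph_hub_graph, of s k l ?x] that SV Nx i j by auto
  have "?x \<in> private_nbhd ?G ?x (S \<union> {?x})"
    using x_undom by (auto simp: in_private_nbhd_iff self_in_closed_nbhd)
  moreover have "private_nbhd ?G s (S \<union> {?x}) \<noteq> {}" if s: "s \<in> S" for s
  proof -
    have "\<exists>p \<in> private_nbhd ?G s S. p \<noteq> hub i"
    proof (cases "hub i \<in> private_nbhd ?G s S")
      case True
      then have s_nbr: "hub i \<in> closed_nbhd ?G s"
        and other: "\<And>u. u \<in> S \<Longrightarrow> u \<noteq> s \<Longrightarrow> hub i \<notin> closed_nbhd ?G u"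
        by (auto simp: in_private_nbhd_iff)
      \<comment> \<open>All core vertices and all pendants of \<open>hub i\<close> dominate
        \<open>hub i\<close>, so privacy of \<open>hub i\<close> excludes from \<open>S\<close> all
        of them except possibly \<open>s\<close>.\<close>
      have core_S: "core j' \<notin> S" if "j' < k - 1" "core j' \<noteq> s" for j'
        using other[of "core j'"] that i by (auto simp: closed_nbhd_core)
      have pend_S: "pend i j' \<notin> S" if "j' < 2 * k + l" "pend i j' \<noteq> s" for j'
        using other[of "pend i j'"] that i by (auto simp: closed_nbhd_pend)
      \<comment> \<open>A pendant of \<open>hub i\<close> is dominated only by itself,
        \<open>hub i\<close> and at most one core vertex. None of these lies in \<open>S\<close>
        unless it is \<open>s\<close>, so any such pendant dominated by \<open>s\<close> is private
        to \<open>s\<close>.\<close>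
      have priv: "p \<in> private_nbhd ?G s S"
        if p: "p = pend i j'" "j' < 2 * k + l" "p \<in> closed_nbhd ?G s" for p j'
        unfolding in_private_nbhd_iff
      proof (intro conjI ballI impI notI)
        fix u assume u: "u \<in> S" "u \<noteq> s" "p \<in> closed_nbhd ?G u"
        then have "u \<in> closed_nbhd ?G p"
          using closed_nbhd_sym[OF pair_graph_hub_graph] SV by blast
        then show False
          using u p core_S[of j'] pend_S[of j'] i by (auto simp: closed_nbhd_pend split: if_splits)
      qed (fact p)
      from s SV have "s \<in> pverts ?G" by auto
      then show ?thesis
      proof (cases rule: hub_graph_cases)
        case (hub i')
        then show ?thesis using s_nbr s i by (auto simp: closed_nbhd_hub)
      next
        case (core j')
        then show ?thesis
          using priv[of "pend i j'" j'] i by (intro bexI[of _ "pend i j'"]) (auto simp: closed_nbhd_core)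
      next
        case (pend i' j')
        then have "i' = i"
          using s_nbr by (auto simp: closed_nbhd_pend split: if_splits)
        then show ?thesis
          using priv[of s j'] pend by (intro bexI[of _ s]) (auto simp: self_in_closed_nbhd)
      qed
    next
      case False
      then show ?thesis using S s by (auto simp: irredundant_def)
    qed
    then obtain p where p: "p \<in> private_nbhd ?G s S" "p \<noteq> hub i" by blast
    \<comment> \<open>No vertex of \<open>S\<close> dominates \<open>?x\<close>; hence
      \<open>p\<close> avoids the whole closed neighborhood of \<open>?x\<close> and stays
      private.\<close>
    then have "p \<noteq> ?x"
      using x_undom[OF s] by (auto simp: in_private_nbhd_iff)
    with p have "p \<in> private_nbhd ?G s (S \<union> {?x})"
      using Nx by (auto simp: in_private_nbhd_iff)
    then show ?thesis by blast
  qed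
  ultimately show ?thesis
    using SV x by (auto simp: irredundant_def)
qed

text \<open>If a hub is missing, maximality and \<open>irredundant_insert_pend\<close> force all its
  degree-one pendants into \<open>S\<close>. The bound \<open>k + l\<close> exceeds both
  \<open>l\<close> and \<open>k + l - 1\<close>, so the second alternative never attains either
  minimum.\<close>

lemma maximal_irredundant_hub_graph:
  assumes "maximal_irredundant (hub_graph k l) S"
  shows "hub ` {..<l} \<subseteq> S \<or> k + l \<le> card S"
proof (rule disjCI)
  assume "\<not> k + l \<le> card S"
  then have small: "card S < k + l" by simp
  have irr: "irredundant (hub_graph k l) S"
    and max: "\<And>w. w \<in> pverts (hub_graph k l) - S \<Longrightarrow> \<not> irredundant (hub_graph k l) (S \<union> {w})"
    using assms by (auto simp: maximal_irredundant_def)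
  show "hub ` {..<l} \<subseteq> S"
  proof (rule ccontr)
    assume "\<not> hub ` {..<l} \<subseteq> S"
    then obtain i where i: "i < l" "hub i \<notin> S" by auto
    \<comment> \<open>Starting at \<open>k\<close> leaves out the degree-one pendant with index
      \<open>k - 1\<close> and makes the count exactly \<open>k + l\<close>.\<close>
    have "pend i ` {k..<2 * k + l} \<subseteq> S"
    proof (rule ccontr)
      assume "\<not> pend i ` {k..<2 * k + l} \<subseteq> S"
      then obtain j where "k \<le> j" "j < 2 * k + l" "pend i j \<notin> S"
        unfolding image_subset_iff by (meson atLeastLessThan_iff)
      then show False
        using irredundant_insert_pend[OF irr i, of j] max[of "pend i j"] i
        by (auto simp: pverts_hub_graph)
    qed
    then have "card (pend i ` {k..<2 * k + l}) \<le> card S"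
      using finite_maximal_irredundant[OF assms] by (rule card_mono[rotated])
    then show False
      using small by (simp add: card_image inj_on_def)
  qed
qed

section \<open>Lower bound and explicit colorings\<close>

lemma card_proper_coloring_ge:
  assumes c: "proper_coloring (hub_graph k l) c" and A: "A \<subseteq> {..<l}" and inj: "inj_on c (hub ` A)"
  shows "card A + (k - 1) \<le> card (c ` pverts (hub_graph k l))"
proof -
  let ?G = "hub_graph k l"
  have ne: "c u \<noteq> c v" if "(u, v) \<in> edges k l" for u v
    using c that by (auto simp: proper_coloring_def parcs_hub_graph)
  have core_ne: "c (core i) \<noteq> c (core j)" if "i < k - 1" "j < k - 1" "i \<noteq> j" for i j
    using that by (intro ne) (auto simp: edges_def)
  have hub_core_ne: "c (hub i) \<noteq> c (core j)" if "i < l" "j < k - 1" for i j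
    using that by (intro ne) (auto simp: edges_def)
  \<comment> \<open>The core is a clique joined to every hub, so hubs with distinct colors together
    with the core use distinct colors throughout. The set \<open>A\<close> will be one hub index for
    the chromatic number and all of them for the irredundance chromatic number.\<close>
  have "hub ` A \<union> core ` {..<k - 1} \<subseteq> pverts ?G"
    using A by (auto simp: pverts_hub_graph)
  then have "card (c ` (hub ` A \<union> core ` {..<k - 1})) \<le> card (c ` pverts ?G)"
    by (intro card_mono image_mono finite_imageI finite_pverts_hub_graph)
  moreover have "inj_on c (core ` {..<k - 1})"
    using core_ne by (auto simp: inj_on_def)
  then have "inj_on c (hub ` A \<union> core ` {..<k - 1})"
    using inj A hub_core_ne by (auto simp: inj_on_Un)
  moreover have "card (hub ` A \<union> core ` {..<k - 1}) = card A + (k - 1)"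
    using A finite_subset[OF A] by (subst card_Un_disjoint) (auto simp: card_image inj_on_def)
  ultimately show ?thesis
    by (simp add: card_image)
qed

text \<open>The hub colors \<open>f\<close> are left open so that hubs can share a color or have
  distinct ones. Pendants reuse the core colors 0 and 1; index 0 gets 1 because that pendant is
  adjacent to \<open>core 0\<close>, which has color 0.\<close>

definition hub_coloring :: "(nat \<Rightarrow> nat) \<Rightarrow> nat \<Rightarrow> nat" where
  "hub_coloring f v =
     (if v mod 3 = 0 then f (v div 3)
      else if v mod 3 = 1 then v div 3
      else if snd (prod_decode (v div 3)) = 0 then 1 else 0)"

lemma hub_coloring_simps [simp]:
  "hub_coloring f (hub i) = f i"
  "hub_coloring f (core j) = j"
  "hub_coloring f (pend i j) = (if j = 0 then 1 else 0)"
proof -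
  have "(3 * n + 2) div 3 = n" "(3 * n + 2) mod 3 = 2" for n :: nat
    by presburger+
  then show "hub_coloring f (pend i j) = (if j = 0 then 1 else 0)"
    by (simp add: hub_coloring_def pend_def)
qed (simp_all add: hub_coloring_def hub_def core_def)

text \<open>Core colors are below \<open>k - 1\<close> and hub colors are not. Since
  \<open>k - 1\<close> is at least 2, the pendant colors 0 and 1 also differ from every hub
  color.\<close>

lemma proper_hub_coloring:
  assumes "k \<ge> 3" "\<And>i. i < l \<Longrightarrow> k - 1 \<le> f i"
  shows "proper_coloring (hub_graph k l) (hub_coloring f)"
proof -
  have "hub_coloring f u \<noteq> hub_coloring f v" if "(u, v) \<in> edges k l" for u v
    using that assms(1) by (auto simp: edges_def split: if_splits dest!: assms(2))
  then show ?thesis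
    by (fastforce simp: proper_coloring_def parcs_hub_graph)
qed

lemma card_hub_coloring_le:
  assumes "k \<ge> 3" "k \<le> n" "\<And>i. i < l \<Longrightarrow> f i < n"
  shows "card (hub_coloring f ` pverts (hub_graph k l)) \<le> n"
proof -
  have "hub_coloring f ` pverts (hub_graph k l) \<subseteq> {..<n}"
    using assms by (auto simp: pverts_hub_graph)
  then show ?thesis
    using card_mono[of "{..<n}"] by simp
qed

lemma chromatic_number_hub_graph:
  assumes "k \<ge> 3" "l \<ge> 1"
  shows "chromatic_number (hub_graph k l) = k"
  unfolding chromatic_number_def
proof (rule Least_equality)
  \<comment> \<open>\<open>hub 0\<close> and the core form a clique of size
    \<open>k\<close>.\<close>
  have lower: "k \<le> card (c ` pverts (hub_graph k l))" if "proper_coloring (hub_graph k l) c" for c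
    using card_proper_coloring_ge[OF that, of "{0}"] assms by auto
  \<comment> \<open>The hubs are pairwise nonadjacent, so one color beyond those of the core serves
    them all.\<close>
  have "proper_coloring (hub_graph k l) (hub_coloring (\<lambda>_. k - 1))"
    using assms by (intro proper_hub_coloring) auto
  moreover have "card (hub_coloring (\<lambda>_. k - 1) ` pverts (hub_graph k l)) \<le> k"
    using assms by (intro card_hub_coloring_le) auto
  ultimately show "\<exists>c. proper_coloring (hub_graph k l) c \<and> card (c ` pverts (hub_graph k l)) = k"
    using lower le_antisym by blast
  show "k \<le> n" if "\<exists>c. proper_coloring (hub_graph k l) c \<and> card (c ` pverts (hub_graph k l)) = n"
    for n
    using that lower by blast
qed

lemma lower_irredundance_number_hub_graph:
  assumes "k \<ge> 3" "l \<ge> 1"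
  shows "lower_irredundance_number (hub_graph k l) = l"
  unfolding lower_irredundance_number_def
proof (rule Least_equality)
  have card_hubs: "card (hub ` {..<l}) = l"
    by (simp add: card_image inj_on_def)
  then show "\<exists>S. maximal_irredundant (hub_graph k l) S \<and> card S = l"
    using maximal_irredundant_hubs[of l k] assms by auto
  fix n assume "\<exists>S. maximal_irredundant (hub_graph k l) S \<and> card S = n"
  then obtain S where S: "maximal_irredundant (hub_graph k l) S" "card S = n" by blast
  have "l \<le> n" if "hub ` {..<l} \<subseteq> S"
    using card_mono[OF finite_maximal_irredundant[OF S(1)] that] card_hubs S(2) by simp
  then show "l \<le> n"
    using maximal_irredundant_hub_graph[OF S(1)] S(2) by linarith
qed

lemma irredundance_chromatic_number_hub_graph:
  assumes "k \<ge> 3" "l \<ge> 1"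
  shows "irredundance_chromatic_number (hub_graph k l) = k + l - 1"
  unfolding irredundance_chromatic_number_def
proof (rule Least_equality)
  let ?G = "hub_graph k l" and ?c = "hub_coloring (\<lambda>i. k - 1 + i)"
  \<comment> \<open>Either \<open>R\<close> contains all hubs, whose \<open>l\<close> distinct
    colors add to the \<open>k - 1\<close> core colors, or \<open>R\<close> alone already needs
    \<open>k + l\<close> colors.\<close>
  have lower: "k + l - 1 \<le> card (c ` pverts ?G)" if c: "irredundance_coloring ?G c" for c
  proof -
    from c obtain R where proper: "proper_coloring ?G c" and R: "maximal_irredundant ?G R" "inj_on c R"
      by (auto simp: irredundance_coloring_def)
    have "R \<subseteq> pverts ?G"
      using R by (auto simp: maximal_irredundant_def irredundant_def)
    then have "card R \<le> card (c ` pverts ?G)"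
      using R(2) finite_pverts_hub_graph by (metis card_image card_mono finite_imageI image_mono)
    moreover have "l + (k - 1) \<le> card (c ` pverts ?G)" if "hub ` {..<l} \<subseteq> R"
      using card_proper_coloring_ge[OF proper, of "{..<l}"] inj_on_subset[OF R(2) that] by simp
    ultimately show ?thesis
      using maximal_irredundant_hub_graph[OF R(1)] by linarith
  qed
  \<comment> \<open>The hub colors run from \<open>k - 1\<close> to \<open>k + l - 2\<close>,
    directly after the core colors, so the hubs are a maximal irredundant set with distinct
    colors.\<close>
  have "proper_coloring ?G ?c"
    using assms by (intro proper_hub_coloring) auto
  moreover have "inj_on ?c (hub ` {..<l})"
    by (auto simp: inj_on_def)
  ultimately have "irredundance_coloring ?G ?c"
    using maximal_irredundant_hubs[of l k] assms by (auto simp: irredundance_coloring_def)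
  moreover have "card (?c ` pverts ?G) \<le> k + l - 1"
    using assms by (intro card_hub_coloring_le) auto
  ultimately show "\<exists>c. irredundance_coloring ?G c \<and> card (c ` pverts ?G) = k + l - 1"
    using lower le_antisym by blast
  show "k + l - 1 \<le> n" if "\<exists>c. irredundance_coloring ?G c \<and> card (c ` pverts ?G) = n" for n
    using that lower by blast
qed

theorem theorem2:
  fixes k l :: nat
  assumes "k \<ge> 3" and "l \<ge> 1"
  shows "\<exists>G :: nat pair_pre_digraph.
           pair_graph G \<and> connected (with_proj G) \<and>
           chromatic_number G = k \<and>
           lower_irredundance_number G = l \<and>
           irredundance_chromatic_number G = k + l - 1"
  using assms pair_graph_hub_graph[of k l] connected_hub_graph[of l k]
    chromatic_number_hub_graph[of k l] lower_irredundance_number_hub_graph[of k l]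
    irredundance_chromatic_number_hub_graph[of k l]
  by (intro exI[of _ "hub_graph k l"]) simp

end
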